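(* Consider the spherical Kepler–Coulomb problem with mass factor $m\in\mathbb{R}\setminus\{0\}$ and antipodal centers $\pm Z_1$ on the unit sphere $S\subset\mathbb{R}^3$. Let the wall of reflection be either (i) a circle on $S$ (small or great) whose centers are $\pm Z_1$, i.e. the intersection of $S$ with a plane orthogonal to $Z_1$, or (ii) an arbitrary great circle of $S$. Consider the billiard system whose dynamics takes place on either one of the two sides of the wall: the particle moves according to the spherical Kepler–Coulomb problem on the chosen side and is reflected at the wall by the natural elastic law of reflection on the sphere. Then this billiard system is integrable, i.e. it has two functionally independent conserved quantities.
   Context: **Spherical Kepler–Coulomb problem.** With mass factor $m\ne0$ and centers $\pm Z_1\in S$: the mechanical system $\nabla_{\dot q}\dot q=\mathrm{grad}\,U$ on $S\setminus\{Z_1,-Z_1\}$ with the round metric of the unit sphere and the force function $U(q)=m\cot\theta$, where $\theta\in(0,\pi)$ is the angle between $q$ and $Z_1$. Its energy is $\tfrac12\|\dot q\|^2-m\cot\theta$. One of the two singular centers is attractive and the other is repulsive, depending on the sign of $m$. **Billiard conventions.** At the wall, the component of the velocity normal to the wall (in the tangent plane of $S$, with respect to the round metric) changes sign and the tangential component is unchanged. Not every orbit starting at the wall needs to return to it; the billiard map may be only partially defined. Collisions with the attractive center are regularized by elastic bouncing: the particle is ejected back along the same great circle arc with the same energy. When the centers lie on the wall, one may alternatively remove them from the wall. The repulsive center is not reached at finite energy. **Integrability.** A billiard system is called integrable when there exist two functionally independent quantities on the phase space (their differentials are linearly independent on a dense open subset) that are conserved both along the motion and under the reflections. *)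

theory Defs
  imports "HOL-Analysis.Analysis"
begin

text \<open>
  Points of the unit sphere \<open>S = sphere 0 1\<close> and tangent vectors are written in the ambient
  \<open>real^3\<close>; a state is a pair of a position and a velocity.
\<close>

type_synonym state = "(real^3) \<times> (real^3)"

definition force_function :: "real \<Rightarrow> real^3 \<Rightarrow> real^3 \<Rightarrow> real" where
  "force_function m Z q = m * cot (arccos (q \<bullet> Z))"

definition energy :: "real \<Rightarrow> real^3 \<Rightarrow> state \<Rightarrow> real" where
  "energy m Z = (\<lambda>(q, v). (norm v)\<^sup>2 / 2 - force_function m Z q)"

text \<open>
  \<open>sphere_gradient f q g\<close>: the vector \<open>g\<close> is the gradient at \<open>q\<close> of the restriction of \<open>f\<close>
  to \<open>S\<close>.  The derivative within \<open>S\<close> only sees tangential increments, so tangency makes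
  \<open>g\<close> unique.
\<close>

definition sphere_gradient :: "(real^3 \<Rightarrow> real) \<Rightarrow> real^3 \<Rightarrow> real^3 \<Rightarrow> bool" where
  "sphere_gradient f q g \<longleftrightarrow>
     g \<bullet> q = 0 \<and> (f has_derivative (\<lambda>h. g \<bullet> h)) (at q within sphere 0 1)"

definition tangential_part :: "real^3 \<Rightarrow> real^3 \<Rightarrow> real^3" where
  "tangential_part q w = w - (w \<bullet> q) *\<^sub>R q"

text \<open>The table \<open>D\<close> is a closed side of the wall; the two centers are excluded.\<close>

definition phase_space :: "real^3 \<Rightarrow> (real^3) set \<Rightarrow> state set" where
  "phase_space Z D = {(q, v). q \<in> D - {Z, - Z} \<and> v \<bullet> q = 0}"

text \<open>
  The covariant derivative of the velocity on \<open>S\<close> is the tangential part of the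
  acceleration in \<open>real^3\<close>.
\<close>

definition kepler_motion ::
  "real \<Rightarrow> real^3 \<Rightarrow> (real^3) set \<Rightarrow> real set \<Rightarrow> (real \<Rightarrow> real^3) \<Rightarrow> (real \<Rightarrow> real^3) \<Rightarrow> bool"
where
  "kepler_motion m Z D I q v \<longleftrightarrow>
     (\<forall>t\<in>I. (q t, v t) \<in> phase_space Z D \<and>
        (q has_vector_derivative v t) (at t within I) \<and>
        (\<exists>a. (v has_vector_derivative a) (at t within I) \<and>
             sphere_gradient (force_function m Z) (q t) (tangential_part (q t) a)))"

definition attractive_center :: "real \<Rightarrow> real^3 \<Rightarrow> real^3" where
  "attractive_center m Z = (if m > 0 then Z else - Z)"

text \<open>The great half circle from \<open>C\<close> to \<open>- C\<close> with initial direction \<open>e\<close>.\<close>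

definition great_arc :: "real^3 \<Rightarrow> real^3 \<Rightarrow> (real^3) set" where
  "great_arc C e = (\<lambda>s. cos s *\<^sub>R C + sin s *\<^sub>R e) ` {0..pi}"

text \<open>
  The wall is \<open>{q \<in> S. q \<bullet> n = c}\<close>.  Its normal inside the tangent plane of \<open>S\<close> at
  \<open>q\<close> is the gradient on \<open>S\<close> of the height \<open>q \<bullet> n\<close>, normalized.
\<close>

definition wall :: "real^3 \<Rightarrow> real \<Rightarrow> (real^3) set" where
  "wall n c = {q \<in> sphere 0 1. q \<bullet> n = c}"

definition wall_normal :: "real^3 \<Rightarrow> real^3 \<Rightarrow> real^3" where
  "wall_normal n q = sgn (tangential_part q n)"

definition reflect_velocity :: "real^3 \<Rightarrow> real^3 \<Rightarrow> real^3 \<Rightarrow> real^3" where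
  "reflect_velocity n q v = v - (2 * (v \<bullet> wall_normal n q)) *\<^sub>R wall_normal n q"

text \<open>
  The rule \<open>bounce\<close> is the elastic bouncing at the attractive center: a motion colliding
  with \<open>C\<close> at time \<open>t0\<close> is continued by the motion ejected from \<open>C\<close> along the same
  great circle arc with the same energy.  The centers never count as wall points, so this is also
  the rule when \<open>C\<close> lies on the wall.
\<close>

inductive billiard_step ::
  "real \<Rightarrow> real^3 \<Rightarrow> real^3 \<Rightarrow> real \<Rightarrow> (real^3) set \<Rightarrow> state \<Rightarrow> state \<Rightarrow> bool"
  for m Z n c D
where
  motion: "\<lbrakk>a \<le> b; kepler_motion m Z D {a..b} q v\<rbrakk>
     \<Longrightarrow> billiard_step m Z n c D (q a, v a) (q b, v b)"
| reflection: "\<lbrakk>(q, v) \<in> phase_space Z D; q \<in> wall n c\<rbrakk>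
     \<Longrightarrow> billiard_step m Z n c D (q, v) (q, reflect_velocity n q v)"
| bounce: "\<lbrakk>a < t0; t0 < b; C = attractive_center m Z;
      kepler_motion m Z D {a..<t0} q v; (q \<longlongrightarrow> C) (at_left t0);
      kepler_motion m Z D {t0<..b} q' v'; (q' \<longlongrightarrow> C) (at_right t0);
      norm e = 1; e \<bullet> C = 0; q ` {a..<t0} \<union> q' ` {t0<..b} \<subseteq> great_arc C e;
      energy m Z (q' b, v' b) = energy m Z (q a, v a)\<rbrakk>
     \<Longrightarrow> billiard_step m Z n c D (q a, v a) (q' b, v' b)"

text \<open>
  \<open>C1_with_gradient P F G\<close>: \<open>F\<close> is continuously differentiable on \<open>P\<close>, its
  differential at \<open>p\<close> being the restriction of \<open>G p \<bullet> _\<close> to the tangent space of \<open>P\<close>.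
  The normal component of \<open>G p\<close> is arbitrary and plays no role below.
\<close>

definition C1_with_gradient :: "state set \<Rightarrow> (state \<Rightarrow> real) \<Rightarrow> (state \<Rightarrow> state) \<Rightarrow> bool" where
  "C1_with_gradient P F G \<longleftrightarrow> continuous_on P G \<and>
     (\<forall>p\<in>P. (F has_derivative (\<lambda>h. G p \<bullet> h)) (at p within P))"

text \<open>
  The tangent space of the tangent bundle of \<open>S\<close> at \<open>(q, v)\<close>, obtained by linearizing
  \<open>q \<bullet> q = 1\<close> and \<open>v \<bullet> q = 0\<close>.
\<close>

definition phase_tangent :: "state \<Rightarrow> state set" where
  "phase_tangent = (\<lambda>(q, v). {(x, y). x \<bullet> q = 0 \<and> y \<bullet> q + v \<bullet> x = 0})"

definition functionally_independent ::
  "state set \<Rightarrow> (state \<Rightarrow> real) \<Rightarrow> (state \<Rightarrow> real) \<Rightarrow> bool"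
where
  "functionally_independent P F1 F2 \<longleftrightarrow>
     (\<exists>G1 G2 V. C1_with_gradient P F1 G1 \<and> C1_with_gradient P F2 G2 \<and>
        openin (top_of_set P) V \<and> P \<subseteq> closure V \<and>
        (\<forall>p\<in>V. \<forall>\<alpha> \<beta>. (\<forall>h\<in>phase_tangent p. \<alpha> * (G1 p \<bullet> h) + \<beta> * (G2 p \<bullet> h) = 0)
                  \<longrightarrow> \<alpha> = 0 \<and> \<beta> = 0))"

definition conserved_quantity ::
  "real \<Rightarrow> real^3 \<Rightarrow> real^3 \<Rightarrow> real \<Rightarrow> (real^3) set \<Rightarrow> (state \<Rightarrow> real) \<Rightarrow> bool"
where
  "conserved_quantity m Z n c D F \<longleftrightarrow>
     (\<forall>x y. billiard_step m Z n c D x y \<longrightarrow> F y = F x)"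

definition integrable_billiard ::
  "real \<Rightarrow> real^3 \<Rightarrow> real^3 \<Rightarrow> real \<Rightarrow> (real^3) set \<Rightarrow> bool"
where
  "integrable_billiard m Z n c D \<longleftrightarrow>
     (\<exists>F1 F2. conserved_quantity m Z n c D F1 \<and> conserved_quantity m Z n c D F2 \<and>
        functionally_independent (phase_space Z D) F1 F2)"

end

theory Submission imports Defs begin

text \<open>
  Write \<open>L = q \<times> v\<close>, \<open>\<rho> = sqrt (1 - (q \<bullet> Z)\<^sup>2)\<close> and let \<open>w\<close> be the part of \<open>n\<close>
  orthogonal to \<open>Z\<close>.  Central projection to the tangent plane at \<open>Z\<close> turns the spherical
  problem into the planar Kepler problem, whose Laplace--Runge--Lenz vector pulls back to
  \<open>(L \<bullet> Z) (L \<bullet> w) + m (q \<bullet> w) / \<rho>\<close> in the direction \<open>w\<close>; this and \<open>L \<bullet> Z\<close> are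
  conserved by the motion.  On the great circle \<open>q \<bullet> n = 0\<close> a reflection keeps \<open>L \<bullet> n\<close> and
  replaces \<open>L \<bullet> Z\<close> by \<open>2 (n \<bullet> Z) (L \<bullet> n) - L \<bullet> Z\<close>, so it preserves
  \<open>2 (n \<bullet> Z) (L \<bullet> Z) (L \<bullet> n) - (L \<bullet> Z)\<^sup>2 + 2 m (n \<bullet> Z) (q \<bullet> w) / \<rho>\<close>,
  which is a combination of the two.  For \<open>n = Z\<close> it reduces to \<open>(L \<bullet> Z)\<^sup>2\<close>, which
  also serves the circles centered at \<open>Z\<close>.  Together with the energy it gives integrability.
\<close>

section \<open>Second integral and ambient gradients\<close>

definition triple :: "real^3 \<Rightarrow> real^3 \<Rightarrow> real^3 \<Rightarrow> real" where
  "triple a b c = a \<bullet> cross3 b c"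

definition rad :: "real^3 \<Rightarrow> real^3 \<Rightarrow> real" where
  "rad Z q = sqrt (1 - (q \<bullet> Z)\<^sup>2)"

definition horizontal_part :: "real^3 \<Rightarrow> real^3 \<Rightarrow> real^3" where
  "horizontal_part Z n = n - (n \<bullet> Z) *\<^sub>R Z"

definition second_integral :: "real \<Rightarrow> real^3 \<Rightarrow> real^3 \<Rightarrow> state \<Rightarrow> real" where
  "second_integral m Z n = (\<lambda>(q, v).
     2 * (n \<bullet> Z) * triple Z q v * triple n q v - (triple Z q v)\<^sup>2
     + 2 * m * (n \<bullet> Z) * (q \<bullet> horizontal_part Z n) / rad Z q)"

text \<open>With \<open>s = q \<bullet> Z\<close> the force function is
  \<open>m * s / sqrt (1 - s\<^sup>2)\<close>, whose derivative in s is the coefficient of Z up to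
  sign. The gradient is the ambient one, not projected to the sphere.\<close>

definition energy_gradient :: "real \<Rightarrow> real^3 \<Rightarrow> state \<Rightarrow> state" where
  "energy_gradient m Z = (\<lambda>(q, v). (- (m / rad Z q ^ 3) *\<^sub>R Z, v))"

text \<open>The expression \<open>triple a q v\<close> has gradient \<open>cross3 v a\<close> in q
  and \<open>cross3 a q\<close> in v; the product rule gives the velocity terms, and the last two
  position terms differentiate the quotient by \<open>rad Z q\<close>.\<close>

definition second_integral_gradient :: "real \<Rightarrow> real^3 \<Rightarrow> real^3 \<Rightarrow> state \<Rightarrow> state" where
  "second_integral_gradient m Z n = (\<lambda>(q, v).
     ((2 * (n \<bullet> Z) * triple n q v - 2 * triple Z q v) *\<^sub>R cross3 v Z
        + (2 * (n \<bullet> Z) * triple Z q v) *\<^sub>R cross3 v n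
        + (2 * m * (n \<bullet> Z) / rad Z q) *\<^sub>R horizontal_part Z n
        + (2 * m * (n \<bullet> Z) * (q \<bullet> horizontal_part Z n) * (q \<bullet> Z) / rad Z q ^ 3) *\<^sub>R Z,
      (2 * (n \<bullet> Z) * triple n q v - 2 * triple Z q v) *\<^sub>R cross3 Z q
        + (2 * (n \<bullet> Z) * triple Z q v) *\<^sub>R cross3 n q))"

section \<open>Triple product algebra\<close>

lemma triple_cyclic: "triple a b c = triple b c a"
  unfolding triple_def by (simp add: cross3_simps)

lemma triple_swap: "triple a c b = - triple a b c"
  unfolding triple_def by (simp add: cross3_simps)

lemma triple_refl [simp]: "triple a a b = 0" "triple a b a = 0" "triple a b b = 0"
  unfolding triple_def by (simp_all add: dot_cross_self)

lemma triple_add: "triple (a + a') b c = triple a b c + triple a' b c"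
  "triple a (b + b') c = triple a b c + triple a b' c"
  "triple a b (c + c') = triple a b c + triple a b c'"
  unfolding triple_def by (simp_all add: inner_add cross_add_left cross_add_right)

lemma triple_diff: "triple (a - a') b c = triple a b c - triple a' b c"
  "triple a (b - b') c = triple a b c - triple a b' c"
  "triple a b (c - c') = triple a b c - triple a b c'"
  unfolding triple_def
  by (simp_all add: inner_diff Cross3.left_diff_distrib Cross3.right_diff_distrib)

lemma triple_scaleR: "triple (r *\<^sub>R a) b c = r * triple a b c"
  "triple a (r *\<^sub>R b) c = r * triple a b c"
  "triple a b (r *\<^sub>R c) = r * triple a b c"
  unfolding triple_def by (simp_all add: cross_mult_left cross_mult_right)

text \<open>Multiplicativity of the determinant: the right side is the determinant of the matrix of
  inner products, expanded along its first row.\<close>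

lemma triple_mult_triple:
  "triple a b c * triple a' b' c' =
     (a \<bullet> a') * ((b \<bullet> b') * (c \<bullet> c') - (b \<bullet> c') * (c \<bullet> b'))
   - (a \<bullet> b') * ((b \<bullet> a') * (c \<bullet> c') - (b \<bullet> c') * (c \<bullet> a'))
   + (a \<bullet> c') * ((b \<bullet> a') * (c \<bullet> b') - (b \<bullet> b') * (c \<bullet> a'))"
  unfolding triple_def inner_vec_def sum_3 cross_components cross3_def vector_3 inner_real_def
  by algebra

lemma bounded_bilinear_cross3: "bounded_bilinear cross3"
  using bilinear_cross bilinear_conv_bounded_bilinear by blast

lemmas [derivative_intros] = bounded_bilinear.FDERIV [OF bounded_bilinear_cross3]

lemmas [continuous_intros] = continuous_on_cross

section \<open>Distance from the axis and the force function\<close>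

lemma inner_strictly_between:
  assumes "norm Z = 1" "norm q = 1" "q \<noteq> Z" "q \<noteq> - Z"
  shows "\<bar>q \<bullet> Z\<bar> < 1"
proof -
  have "\<bar>q \<bullet> Z\<bar> \<le> 1" using Cauchy_Schwarz_ineq2[of q Z] assms by simp
  moreover have "q \<bullet> Z \<noteq> 1" "q \<bullet> Z \<noteq> -1"
    using assms norm_cauchy_schwarz_abs_eq[of q Z] by auto
  ultimately show ?thesis by linarith
qed

lemma rad_pos: "norm Z = 1 \<Longrightarrow> norm q = 1 \<Longrightarrow> q \<noteq> Z \<Longrightarrow> q \<noteq> - Z \<Longrightarrow> 0 < rad Z q"
  using inner_strictly_between[of Z q] abs_square_less_1[of "q \<bullet> Z"] by (simp add: rad_def)

lemma rad_square: "norm Z = 1 \<Longrightarrow> norm q = 1 \<Longrightarrow> (rad Z q)\<^sup>2 = 1 - (q \<bullet> Z)\<^sup>2"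
  using Cauchy_Schwarz_ineq2[of q Z] abs_square_le_1[of "q \<bullet> Z"] by (simp add: rad_def)

text \<open>At the centers both sides are 0 through division by zero, so the formula can replace the
  force function on the whole sphere when derivatives within it are taken.\<close>

lemma force_function_eq:
  assumes "norm Z = 1" "norm q = 1"
  shows "force_function m Z q = m * (q \<bullet> Z) / rad Z q"
  using Cauchy_Schwarz_ineq2[of q Z] assms
  by (simp add: force_function_def cot_def rad_def sin_arccos abs_le_iff)

lemma has_derivative_inverse_rad:
  assumes "0 < rad Z q"
  shows "((\<lambda>q. inverse (rad Z q)) has_derivative (\<lambda>h. (q \<bullet> Z) / rad Z q ^ 3 * (h \<bullet> Z))) (at q within S)"
  using assms unfolding rad_def
  by (auto intro!: derivative_eq_intros ext
      simp: field_simps power2_eq_square power3_eq_cube)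

lemma has_derivative_cot_profile:
  assumes "norm Z = 1" "norm q = 1" "0 < rad Z q"
  shows "((\<lambda>q. m * (q \<bullet> Z) / rad Z q) has_derivative (\<lambda>h. m / rad Z q ^ 3 * (h \<bullet> Z))) (at q within S)"
proof -
  have "((\<lambda>q. (m * (q \<bullet> Z)) * inverse (rad Z q)) has_derivative
      (\<lambda>h. m * (q \<bullet> Z) * ((q \<bullet> Z) / rad Z q ^ 3 * (h \<bullet> Z)) + m * (h \<bullet> Z) * inverse (rad Z q))) (at q within S)"
    by (intro has_derivative_mult has_derivative_inverse_rad assms has_derivative_mult_right
        bounded_linear_imp_has_derivative bounded_linear_inner_left)
  moreover have "m * (q \<bullet> Z) * ((q \<bullet> Z) / rad Z q ^ 3 * (h \<bullet> Z)) + m * (h \<bullet> Z) * inverse (rad Z q)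
      = m / rad Z q ^ 3 * (h \<bullet> Z)" for h
  proof -
    have "m * (q \<bullet> Z) * ((q \<bullet> Z) / rad Z q ^ 3 * (h \<bullet> Z)) + m * (h \<bullet> Z) * inverse (rad Z q)
      = m * (h \<bullet> Z) * ((q \<bullet> Z)\<^sup>2 + (rad Z q)\<^sup>2) / rad Z q ^ 3"
      using assms(3) by (simp add: field_simps power2_eq_square power3_eq_cube)
    then show ?thesis by (simp add: rad_square[OF assms(1,2)])
  qed
  ultimately show ?thesis by (simp add: divide_inverse)
qed

section \<open>Gradients on the sphere and the equation of motion\<close>

text \<open>If g and g' differed, their normalized difference h would be a unit tangent vector. The
  zero function, as the difference of f with itself, has derivative
  \<open>(g - g') \<bullet> h\<close> along the great circle through q in direction h, a
  contradiction.\<close>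

lemma sphere_gradient_unique:
  assumes "norm q = 1" "sphere_gradient f q g" "sphere_gradient f q g'"
  shows "g = g'"
proof (rule ccontr)
  assume "g \<noteq> g'"
  define h where "h = sgn (g - g')"
  have hq: "h \<bullet> q = 0" and nh: "norm h = 1"
    using assms \<open>g \<noteq> g'\<close>
    by (auto simp: h_def sgn_div_norm sphere_gradient_def inner_diff_left)
  define \<gamma> where "\<gamma> = (\<lambda>t::real. cos t *\<^sub>R q + sin t *\<^sub>R h)"
  have on: "\<gamma> t \<in> sphere 0 1" for t
  proof -
    have "\<gamma> t \<bullet> \<gamma> t = (cos t)\<^sup>2 * (q \<bullet> q) + (sin t)\<^sup>2 * (h \<bullet> h)"
      using hq by (simp add: \<gamma>_def algebra_simps inner_add power2_eq_square inner_commute[of q h])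
    then have "\<gamma> t \<bullet> \<gamma> t = 1" using nh assms(1) by (simp add: norm_eq_1)
    then show ?thesis by (simp add: norm_eq_1)
  qed
  have dg: "(\<gamma> has_derivative (\<lambda>t. t *\<^sub>R h)) (at 0)"
    unfolding \<gamma>_def by (auto intro!: derivative_eq_intros)
  have "((\<lambda>x. f x - f x) has_derivative (\<lambda>k. g \<bullet> k - g' \<bullet> k)) (at q within sphere 0 1)"
    using assms by (intro has_derivative_diff) (auto simp: sphere_gradient_def)
  then have "((\<lambda>x. 0::real) has_derivative (\<lambda>k. (g - g') \<bullet> k)) (at (\<gamma> 0) within range \<gamma>)"
    by (rule_tac has_derivative_subset[of _ _ _ "sphere 0 1"]) (use on in \<open>auto simp: inner_diff_left \<gamma>_def\<close>)
  from has_derivative_in_compose[OF dg this]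
  have "((\<lambda>x::real. 0::real) has_derivative (\<lambda>t. (g - g') \<bullet> (t *\<^sub>R h))) (at 0)" .
  then have "(\<lambda>t::real. (g - g') \<bullet> (t *\<^sub>R h)) = (\<lambda>t. 0)"
    by (rule has_derivative_unique) simp
  from fun_cong[OF this, of 1] have "(g - g') \<bullet> h = 0" by simp
  then show False using \<open>g \<noteq> g'\<close> by (simp add: h_def sgn_div_norm)
qed

text \<open>The vector is the tangential part of the ambient gradient
  \<open>(m / rad Z q ^ 3) *\<^sub>R Z\<close>.\<close>

lemma kepler_gradient:
  assumes "norm Z = 1" "norm q = 1" "q \<noteq> Z" "q \<noteq> - Z"
  shows "sphere_gradient (force_function m Z) q ((m / rad Z q ^ 3) *\<^sub>R (Z - (q \<bullet> Z) *\<^sub>R q))"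
  unfolding sphere_gradient_def
proof
  have qq: "q \<bullet> q = 1" using assms by (simp add: norm_eq_1)
  show "((m / rad Z q ^ 3) *\<^sub>R (Z - (q \<bullet> Z) *\<^sub>R q)) \<bullet> q = 0"
    by (simp add: inner_diff_left inner_diff_right inner_commute qq)
  define k where "k = m / rad Z q ^ 3"
  have df: "(force_function m Z has_derivative (\<lambda>h. k * (h \<bullet> Z))) (at q within sphere 0 1)"
    unfolding k_def
    by (rule has_derivative_transform[OF _ _ has_derivative_cot_profile[OF assms(1,2) rad_pos[OF assms]]])
      (use assms in \<open>auto simp: force_function_eq\<close>)
  \<comment> \<open>Subtracting a multiple of \<open>y \<bullet> y - 1\<close>, which vanishes on the sphere, makes the gradient tangential.\<close>
  have "(force_function m Z has_derivative (\<lambda>h. (k *\<^sub>R (Z - (q \<bullet> Z) *\<^sub>R q)) \<bullet> h)) (at q within sphere 0 1)"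
  proof (rule has_derivative_transform)
    show "q \<in> sphere 0 1" using assms by simp
    show "force_function m Z y = force_function m Z y - k * (q \<bullet> Z) / 2 * (y \<bullet> y - 1)"
      if "y \<in> sphere 0 1" for y
      using that by (simp add: norm_eq_1)
    show "((\<lambda>y. force_function m Z y - k * (q \<bullet> Z) / 2 * (y \<bullet> y - 1)) has_derivative
      (\<lambda>h. (k *\<^sub>R (Z - (q \<bullet> Z) *\<^sub>R q)) \<bullet> h)) (at q within sphere 0 1)"
      by (rule derivative_eq_intros df ext refl | simp)+
        (simp add: inner_diff_left inner_commute algebra_simps)
  qed
  then show "(force_function m Z has_derivative
      (\<lambda>h. ((m / rad Z q ^ 3) *\<^sub>R (Z - (q \<bullet> Z) *\<^sub>R q)) \<bullet> h)) (at q within sphere 0 1)"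
    by (simp add: k_def)
qed

text \<open>Newton's equation fixes only the tangential part of the ambient acceleration, so
  \<open>a \<bullet> q\<close> stays in the coefficient of q; the conservation laws below use a only
  modulo multiples of q.\<close>

lemma kepler_acceleration:
  assumes "norm Z = 1" "norm q = 1" "q \<noteq> Z" "q \<noteq> - Z"
    and "sphere_gradient (force_function m Z) q (tangential_part q a)"
  shows "a = (m / rad Z q ^ 3) *\<^sub>R Z + ((a \<bullet> q) - m / rad Z q ^ 3 * (q \<bullet> Z)) *\<^sub>R q"
  using sphere_gradient_unique[OF assms(2,5) kepler_gradient[OF assms(1-4)]]
  by (simp add: tangential_part_def algebra_simps)

section \<open>Differentiability of the two integrals\<close>

lemma C1_with_gradient_energy:
  assumes "norm Z = 1" "D \<subseteq> sphere 0 1"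
  shows "C1_with_gradient (phase_space Z D) (energy m Z) (energy_gradient m Z)"
  unfolding C1_with_gradient_def
proof (intro conjI ballI)
  have nz: "rad Z (fst p) \<noteq> 0" if "p \<in> phase_space Z D" for p
    using that assms rad_pos[of Z "fst p"] by (force simp: phase_space_def)
  then show "continuous_on (phase_space Z D) (energy_gradient m Z)"
    unfolding energy_gradient_def split_def rad_def
    by (auto intro!: continuous_intros)
  fix p assume p: "p \<in> phase_space Z D"
  obtain q v where qv: "p = (q, v)" by fastforce
  have q: "norm q = 1" "0 < rad Z q"
    using p assms rad_pos[of Z q] by (auto simp: phase_space_def qv)
  have f: "((\<lambda>p. m * (fst p \<bullet> Z) / rad Z (fst p)) has_derivative (\<lambda>h. m / rad Z q ^ 3 * (fst h \<bullet> Z)))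
      (at p within phase_space Z D)"
    using has_derivative_in_compose[of fst fst p "phase_space Z D", OF _ has_derivative_cot_profile] q assms
    by (simp add: has_derivative_fst qv)
  show "(energy m Z has_derivative (\<lambda>h. energy_gradient m Z p \<bullet> h)) (at p within phase_space Z D)"
  proof (rule has_derivative_transform[OF p])
    show "energy m Z x = (snd x \<bullet> snd x) / 2 - m * (fst x \<bullet> Z) / rad Z (fst x)"
      if "x \<in> phase_space Z D" for x
      using that assms
      by (auto simp: energy_def phase_space_def power2_norm_eq_inner force_function_eq split: prod.splits)
    show "((\<lambda>x. (snd x \<bullet> snd x) / 2 - m * (fst x \<bullet> Z) / rad Z (fst x)) has_derivative
        (\<lambda>h. energy_gradient m Z p \<bullet> h)) (at p within phase_space Z D)"
      by (rule derivative_eq_intros f ext refl | simp)+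
        (simp add: energy_gradient_def qv inner_prod_def inner_commute)
  qed
qed

text \<open>Cyclic invariance turns the cross products into triple products, the form in which the
  product rule, the equation of motion and the independence test evaluate the pairing.\<close>

lemma second_integral_gradient_inner:
  assumes "rad Z q \<noteq> 0"
  shows "second_integral_gradient m Z n (q, v) \<bullet> (x, y) =
     (2 * (n \<bullet> Z) * triple n q v - 2 * triple Z q v) * (triple Z x v + triple Z q y)
     + (2 * (n \<bullet> Z) * triple Z q v) * (triple n x v + triple n q y)
     + 2 * m * (n \<bullet> Z) * (x \<bullet> horizontal_part Z n) / rad Z q
     + 2 * m * (n \<bullet> Z) * (q \<bullet> horizontal_part Z n) * (q \<bullet> Z) / rad Z q ^ 3 * (x \<bullet> Z)"
proof -
  have "cross3 v a \<bullet> x = triple a x v" "cross3 a q \<bullet> y = triple a q y" for a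
    by (simp_all add: triple_def cross3_simps)
  then show ?thesis
    by (simp add: second_integral_gradient_def inner_prod_def inner_add_left algebra_simps inner_commute)
qed

lemma C1_with_gradient_second_integral:
  assumes "norm Z = 1" "D \<subseteq> sphere 0 1"
  shows "C1_with_gradient (phase_space Z D) (second_integral m Z n) (second_integral_gradient m Z n)"
  unfolding C1_with_gradient_def
proof (intro conjI ballI)
  have nz: "rad Z (fst p) \<noteq> 0" if "p \<in> phase_space Z D" for p
    using that assms rad_pos[of Z "fst p"] by (force simp: phase_space_def)
  then show "continuous_on (phase_space Z D) (second_integral_gradient m Z n)"
    unfolding second_integral_gradient_def split_def rad_def triple_def
    by (auto intro!: continuous_intros)
  fix p assume p: "p \<in> phase_space Z D"
  obtain q v where qv: "p = (q, v)" by fastforce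
  have q: "norm q = 1" "0 < rad Z q"
    using p assms rad_pos[of Z q] by (auto simp: phase_space_def qv)
  have f: "((\<lambda>p. inverse (rad Z (fst p))) has_derivative (\<lambda>h. (q \<bullet> Z) / rad Z q ^ 3 * (fst h \<bullet> Z)))
      (at p within phase_space Z D)"
    using has_derivative_in_compose[of fst fst p "phase_space Z D", OF _ has_derivative_inverse_rad] q
    by (simp add: has_derivative_fst qv)
  have t: "((\<lambda>p. triple a (fst p) (snd p)) has_derivative (\<lambda>h. triple a (fst h) v + triple a q (snd h)))
      (at p within phase_space Z D)" for a
    unfolding triple_def
    by (rule derivative_eq_intros refl ext | simp)+ (simp add: qv inner_add_right)
  let ?w = "horizontal_part Z n"
  have "((\<lambda>p. 2 * (n \<bullet> Z) * (triple Z (fst p) (snd p) * triple n (fst p) (snd p))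
        - triple Z (fst p) (snd p) * triple Z (fst p) (snd p)
        + 2 * m * (n \<bullet> Z) * ((fst p \<bullet> ?w) * inverse (rad Z (fst p))))
      has_derivative (\<lambda>h. second_integral_gradient m Z n p \<bullet> h)) (at p within phase_space Z D)"
  proof (rule has_derivative_eq_rhs)
    show "((\<lambda>p. 2 * (n \<bullet> Z) * (triple Z (fst p) (snd p) * triple n (fst p) (snd p))
        - triple Z (fst p) (snd p) * triple Z (fst p) (snd p)
        + 2 * m * (n \<bullet> Z) * ((fst p \<bullet> ?w) * inverse (rad Z (fst p)))) has_derivative
      (\<lambda>h. 2 * (n \<bullet> Z) * (triple Z (fst p) (snd p) * (triple n (fst h) v + triple n q (snd h))
             + (triple Z (fst h) v + triple Z q (snd h)) * triple n (fst p) (snd p))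
         - (triple Z (fst p) (snd p) * (triple Z (fst h) v + triple Z q (snd h))
             + (triple Z (fst h) v + triple Z q (snd h)) * triple Z (fst p) (snd p))
         + 2 * m * (n \<bullet> Z) * ((fst p \<bullet> ?w) * ((q \<bullet> Z) / rad Z q ^ 3 * (fst h \<bullet> Z))
             + (fst h \<bullet> ?w) * inverse (rad Z (fst p)))))
      (at p within phase_space Z D)"
      by (intro has_derivative_add has_derivative_diff has_derivative_mult_right has_derivative_mult f t
          has_derivative_inner_left has_derivative_fst has_derivative_ident)
  qed (use q in \<open>auto simp: fun_eq_iff qv second_integral_gradient_inner field_simps\<close>)
  then show "(second_integral m Z n has_derivative (\<lambda>h. second_integral_gradient m Z n p \<bullet> h))
      (at p within phase_space Z D)"
    by (rule has_derivative_transform[OF p, rotated])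
      (simp add: second_integral_def split_def power2_eq_square field_simps)
qed

section \<open>Conservation along the motion\<close>

text \<open>By the chain rule the derivative of F along a motion is G paired with
  \<open>(v, a)\<close>, so conservation reduces to the pointwise identity
  \<open>flow\<close>.\<close>

lemma conserved_along_motion:
  assumes "norm Z = 1" "D \<subseteq> sphere 0 1" "C1_with_gradient (phase_space Z D) F G"
    and flow: "\<And>q v a. (q, v) \<in> phase_space Z D \<Longrightarrow>
        a = (m / rad Z q ^ 3) *\<^sub>R Z + ((a \<bullet> q) - m / rad Z q ^ 3 * (q \<bullet> Z)) *\<^sub>R q \<Longrightarrow>
        G (q, v) \<bullet> (v, a) = 0"
    and mot: "kepler_motion m Z D {a..b} q v" and "a \<le> b"
  shows "F (q b, v b) = F (q a, v a)"
proof -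
  have "((\<lambda>t. F (q t, v t)) has_derivative (\<lambda>h. 0)) (at t within {a..b})" if t: "t \<in> {a..b}" for t
  proof -
    obtain ac where P: "(q t, v t) \<in> phase_space Z D"
      and dq: "(q has_vector_derivative v t) (at t within {a..b})"
      and dv: "(v has_vector_derivative ac) (at t within {a..b})"
      and g: "sphere_gradient (force_function m Z) (q t) (tangential_part (q t) ac)"
      using mot t unfolding kepler_motion_def by blast
    have "norm (q t) = 1" "q t \<noteq> Z" "q t \<noteq> - Z" using P assms(2) by (auto simp: phase_space_def)
    from flow[OF P kepler_acceleration[OF assms(1) this g]]
    have 0: "G (q t, v t) \<bullet> (v t, ac) = 0" .
    have "((\<lambda>t. (q t, v t)) has_derivative (\<lambda>h. h *\<^sub>R (v t, ac))) (at t within {a..b})"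
      using has_vector_derivative_Pair[OF dq dv] by (simp add: has_vector_derivative_def)
    from has_derivative_in_compose2[OF _ _ t this, of "phase_space Z D" F "\<lambda>p h. G p \<bullet> h"]
    have "((\<lambda>t. F (q t, v t)) has_derivative (\<lambda>h. G (q t, v t) \<bullet> (h *\<^sub>R (v t, ac)))) (at t within {a..b})"
      using assms(3) mot by (auto simp: C1_with_gradient_def kepler_motion_def)
    then show ?thesis using 0 by (simp del: scaleR_Pair)
  qed
  from has_derivative_zero_constant[OF _ this] obtain k
    where "\<forall>t\<in>{a..b}. F (q t, v t) = k" by auto
  then show ?thesis using \<open>a \<le> b\<close> by simp
qed

lemma energy_motion:
  assumes "norm Z = 1" "D \<subseteq> sphere 0 1" "kepler_motion m Z D {a..b} q v" "a \<le> b"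
  shows "energy m Z (q b, v b) = energy m Z (q a, v a)"
proof (rule conserved_along_motion[OF assms(1,2) C1_with_gradient_energy[OF assms(1,2)] _ assms(3,4)])
  fix q v a
  define k where "k = m / rad Z q ^ 3"
  assume "(q, v) \<in> phase_space Z D"
    and "a = (m / rad Z q ^ 3) *\<^sub>R Z + ((a \<bullet> q) - m / rad Z q ^ 3 * (q \<bullet> Z)) *\<^sub>R q"
  then have "v \<bullet> q = 0" and a: "a = k *\<^sub>R Z + ((a \<bullet> q) - k * (q \<bullet> Z)) *\<^sub>R q"
    by (simp_all add: phase_space_def k_def)
  \<comment> \<open>Power balance: the normal part of a drops out because v is tangent, and what is
    left cancels the position part of the energy gradient.\<close>
  have "v \<bullet> a = k * (v \<bullet> Z) + ((a \<bullet> q) - k * (q \<bullet> Z)) * (v \<bullet> q)"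
    using arg_cong[OF a, of "inner v"] by (simp only: inner_add_right inner_scaleR_right)
  then have "v \<bullet> a = k * (v \<bullet> Z)" using \<open>v \<bullet> q = 0\<close> by simp
  then show "energy_gradient m Z (q, v) \<bullet> (v, a) = 0"
    by (simp add: energy_gradient_def inner_prod_def k_def inner_commute)
qed

lemma second_integral_motion:
  assumes "norm Z = 1" "D \<subseteq> sphere 0 1" "kepler_motion m Z D {a..b} q v" "a \<le> b"
  shows "second_integral m Z n (q b, v b) = second_integral m Z n (q a, v a)"
proof (rule conserved_along_motion[OF assms(1,2) C1_with_gradient_second_integral[OF assms(1,2)] _ assms(3,4)])
  fix q v a
  define k where "k = m / rad Z q ^ 3"
  assume P: "(q, v) \<in> phase_space Z D"
    and "a = (m / rad Z q ^ 3) *\<^sub>R Z + ((a \<bullet> q) - m / rad Z q ^ 3 * (q \<bullet> Z)) *\<^sub>R q"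
  then have vq: "v \<bullet> q = 0" and a: "a = k *\<^sub>R Z + ((a \<bullet> q) - k * (q \<bullet> Z)) *\<^sub>R q"
    by (simp_all add: phase_space_def k_def)
  have q: "norm q = 1" "0 < rad Z q" and r2: "(rad Z q)\<^sup>2 = 1 - (q \<bullet> Z)\<^sup>2"
    using P assms rad_pos[of Z q] rad_square[of Z q] by (auto simp: phase_space_def)
  \<comment> \<open>The multiple of q in a vanishes against q. For \<open>b = Z\<close> the right
    side is 0, which is the conservation of \<open>L \<bullet> Z\<close>.\<close>
  have t: "triple b q a = k * triple b q Z" for b
    by (subst a) (simp add: triple_add triple_scaleR)
  have qq: "q \<bullet> q = 1" "Z \<bullet> Z = 1" using q assms(1) by (simp_all add: norm_eq_1)
  \<comment> \<open>Multiplied by k, this says that the Laplace--Runge--Lenz component has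
    derivative 0; expanding the product of triple products as a Gram determinant proves it.\<close>
  have key: "triple Z q v * triple n q Z + (rad Z q)\<^sup>2 * (v \<bullet> horizontal_part Z n)
      + (q \<bullet> horizontal_part Z n) * (q \<bullet> Z) * (v \<bullet> Z) = 0"
    unfolding triple_mult_triple r2
    using vq
    by (simp add: qq horizontal_part_def inner_diff_right inner_commute power2_eq_square algebra_simps)
  have "2 * m * (n \<bullet> Z) * (v \<bullet> horizontal_part Z n) / rad Z q = 2 * k * (n \<bullet> Z) * ((rad Z q)\<^sup>2 * (v \<bullet> horizontal_part Z n))"
    using q by (simp add: k_def power2_eq_square power3_eq_cube)
  moreover have "2 * m * (n \<bullet> Z) * (q \<bullet> horizontal_part Z n) * (q \<bullet> Z) / rad Z q ^ 3 * (v \<bullet> Z)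
    = 2 * k * (n \<bullet> Z) * ((q \<bullet> horizontal_part Z n) * (q \<bullet> Z) * (v \<bullet> Z))"
    by (simp add: k_def)
  ultimately have "second_integral_gradient m Z n (q, v) \<bullet> (v, a) = 2 * k * (n \<bullet> Z) *
     (triple Z q v * triple n q Z + (rad Z q)\<^sup>2 * (v \<bullet> horizontal_part Z n)
      + (q \<bullet> horizontal_part Z n) * (q \<bullet> Z) * (v \<bullet> Z))"
    using q by (simp add: second_integral_gradient_inner t algebra_simps)
  then show "second_integral_gradient m Z n (q, v) \<bullet> (v, a) = 0"
    by (simp add: key)
qed

section \<open>Invariance under reflection\<close>

lemma energy_reflection:
  "energy m Z (q, reflect_velocity n q v) = energy m Z (q, v)"
proof -
  define u where "u = wall_normal n q"
  \<comment> \<open>The case \<open>u = 0\<close> comes from \<open>sgn 0 = 0\<close>, when n has no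
    tangential part at q; the velocity is then left unchanged.\<close>
  have "u \<bullet> u = 1 \<or> u = 0"
    unfolding u_def wall_normal_def
    by (metis norm_eq_1 norm_sgn sgn_zero)
  then have "(v - (2 * (v \<bullet> u)) *\<^sub>R u) \<bullet> (v - (2 * (v \<bullet> u)) *\<^sub>R u) = v \<bullet> v"
    by (auto simp: inner_diff_left inner_diff_right inner_commute algebra_simps)
  then show ?thesis
    by (simp add: energy_def power2_norm_eq_inner reflect_velocity_def u_def)
qed

text \<open>The wall normal lies in the span of Z and q, so the reflection keeps
  \<open>L \<bullet> Z\<close>, through which alone the velocity enters when
  \<open>n = Z\<close>.\<close>

lemma second_integral_reflection_latitude:
  assumes "norm Z = 1"
  shows "second_integral m Z Z (q, reflect_velocity Z q v) = second_integral m Z Z (q, v)"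
proof -
  have "triple Z q (wall_normal Z q) = 0"
    by (simp add: wall_normal_def sgn_div_norm tangential_part_def triple_scaleR triple_diff)
  then have "triple Z q (reflect_velocity Z q v) = triple Z q v"
    by (simp add: reflect_velocity_def triple_diff triple_scaleR)
  then show ?thesis by (simp add: second_integral_def)
qed

text \<open>On the wall, \<open>L \<bullet> Z\<close> is A + B with
  \<open>A = (n \<bullet> Z) * triple n q v\<close> and
  \<open>B = (v \<bullet> n) * triple Z q n\<close>. The velocity terms of the integral add up to
  \<open>A\<^sup>2 - B\<^sup>2\<close>, and the reflection only changes the sign of B.\<close>

lemma second_integral_reflection_great_circle:
  assumes "norm n = 1" "q \<bullet> n = 0" "v \<bullet> q = 0"
  shows "second_integral m Z n (q, reflect_velocity n q v) = second_integral m Z n (q, v)"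
proof -
  have nn: "n \<bullet> n = 1" using assms by (simp add: norm_eq_1)
  have v': "reflect_velocity n q v = v - (2 * (v \<bullet> n)) *\<^sub>R n"
    using assms by (simp add: reflect_velocity_def wall_normal_def tangential_part_def inner_commute sgn_div_norm)
  \<comment> \<open>The part of L orthogonal to n is n \<times> (L \<times> n), and on the wall L
    \<times> n is a multiple of q.\<close>
  have "cross3 n (cross3 (cross3 q v) n) = (n \<bullet> n) *\<^sub>R cross3 q v - (n \<bullet> cross3 q v) *\<^sub>R n"
    by (simp add: cross3_simps forall_3)
  moreover have "cross3 (cross3 q v) n = (q \<bullet> n) *\<^sub>R v - (v \<bullet> n) *\<^sub>R q"
    by (simp add: cross3_simps forall_3)
  ultimately have "cross3 q v = (n \<bullet> cross3 q v) *\<^sub>R n + (v \<bullet> n) *\<^sub>R cross3 q n"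
    using assms nn cross_skew[of n q] by (simp add: cross_mult_right algebra_simps)
  from arg_cong[OF this, of "inner Z"]
  have L: "triple Z q v = (n \<bullet> Z) * triple n q v + (v \<bullet> n) * triple Z q n"
    by (simp add: triple_def inner_add_right inner_commute)
  show ?thesis
    unfolding second_integral_def v' prod.case triple_diff triple_scaleR triple_refl L
    by (simp add: power2_eq_square algebra_simps)
qed

section \<open>Bouncing at the attractive center\<close>

text \<open>On an arc through the centers, q and v lie in the plane of C and e, so
  \<open>L \<bullet> Z = 0\<close> and only the position term is left. Its value depends on the arc
  alone, which matches the motions before and after a collision.\<close>

lemma integrals_on_great_arc:
  assumes "norm Z = 1" "D \<subseteq> sphere 0 1" "C = Z \<or> C = - Z" "norm e = 1" "e \<bullet> C = 0"
    and mot: "kepler_motion m Z D I q v" and "q ` I \<subseteq> great_arc C e"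
    and t: "t \<in> I" "connected I" "I \<noteq> {t}"
  shows "second_integral m Z n (q t, v t) = 2 * m * (n \<bullet> Z) * (e \<bullet> horizontal_part Z n)"
proof -
  have P: "(q t, v t) \<in> phase_space Z D" and dq: "(q has_vector_derivative v t) (at t within I)"
    using mot t by (auto simp: kepler_motion_def)
  have qt: "norm (q t) = 1" and r: "0 < rad Z (q t)" "(rad Z (q t))\<^sup>2 = 1 - (q t \<bullet> Z)\<^sup>2"
    using P assms(1,2) rad_pos[of Z "q t"] rad_square[of Z "q t"] by (auto simp: phase_space_def)
  have "q x \<bullet> cross3 C e = 0" if "x \<in> I" for x
    using assms(7) that by (auto simp: great_arc_def inner_add_left dot_cross_self)
  then have "((\<lambda>x. q x \<bullet> cross3 C e) has_vector_derivative 0) (at t within I)"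
    using t by (intro has_vector_derivative_transform[OF _ _ has_vector_derivative_const[of 0]]) auto
  moreover have "((\<lambda>x. q x \<bullet> cross3 C e) has_vector_derivative v t \<bullet> cross3 C e) (at t within I)"
    by (rule bounded_linear.has_vector_derivative[OF bounded_linear_inner_left dq])
  \<comment> \<open>A connected set with a second point has no isolated point, so derivatives within
    I are unique and v inherits the plane of the arc.\<close>
  moreover have "at t within I \<noteq> bot"
    using connected_imp_perfect[OF \<open>connected I\<close> t(1)] t(1,3) by (force simp: trivial_limit_within)
  ultimately have vN: "triple (v t) C e = 0"
    using vector_derivative_unique_within by (metis triple_def)
  obtain s where s: "0 \<le> s" "s \<le> pi" "q t = cos s *\<^sub>R C + sin s *\<^sub>R e"
    using subsetD[OF assms(7) imageI[OF t(1)]] by (auto simp: great_arc_def)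
  have CC: "C \<bullet> C = 1" using assms(1,3) by (auto simp: norm_eq_1)
  have "triple C (q t) (v t) = 0"
    using vN triple_cyclic[of "v t" C e] by (simp add: s(3) triple_add triple_scaleR)
  then have L: "triple Z (q t) (v t) = 0"
    using assms(3) by (auto simp: triple_def)
  have "q t \<bullet> C = cos s" using CC assms(5) by (simp add: s(3) inner_add_left)
  then have "(q t \<bullet> Z)\<^sup>2 = (cos s)\<^sup>2" using assms(3) by (metis inner_minus_right power2_minus)
  \<comment> \<open>On the half circle \<open>sin s\<close> is nonnegative and equals the root
    without a sign; on a full circle the quotient in the integral would change sign.\<close>
  then have rs: "rad Z (q t) = sin s"
    using sin_ge_zero[OF s(1,2)] by (simp add: rad_def cos_squared_eq)
  have "Z \<bullet> horizontal_part Z n = 0"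
    using assms(1) by (simp add: horizontal_part_def inner_diff_right norm_eq_1 inner_commute)
  then have "C \<bullet> horizontal_part Z n = 0" using assms(3) by auto
  then have "q t \<bullet> horizontal_part Z n = sin s * (e \<bullet> horizontal_part Z n)"
    by (simp add: s(3) inner_add_left)
  then show ?thesis using r rs by (simp add: second_integral_def L)
qed

section \<open>Conservation under every billiard step\<close>

lemma conserved_quantity_energy:
  assumes "norm Z = 1" "D \<subseteq> sphere 0 1"
  shows "conserved_quantity m Z n c D (energy m Z)"
  unfolding conserved_quantity_def
proof (intro allI impI)
  fix x y assume "billiard_step m Z n c D x y"
  then show "energy m Z y = energy m Z x"
    \<comment> \<open>For \<open>bounce\<close> the equality of energies is a premise of the
      rule.\<close>
    by cases (use assms energy_motion energy_reflection in auto)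
qed

lemma conserved_quantity_second_integral:
  assumes "norm Z = 1" "norm n = 1" "D \<subseteq> sphere 0 1" "n = Z \<or> c = 0"
  shows "conserved_quantity m Z n c D (second_integral m Z n)"
  unfolding conserved_quantity_def
proof (intro allI impI)
  fix x y assume "billiard_step m Z n c D x y"
  then show "second_integral m Z n y = second_integral m Z n x"
  proof cases
    case (motion a b q v)
    then show ?thesis using second_integral_motion[OF assms(1,3)] by simp
  next
    case (reflection q v)
    then show ?thesis
      using assms second_integral_reflection_latitude[OF assms(1)]
        second_integral_reflection_great_circle[OF assms(2)]
      by (auto simp: wall_def phase_space_def)
  next
    case (bounce a t0 b C q v q' v' e)
    have C: "C = Z \<or> C = - Z" using bounce by (auto simp: attractive_center_def)
    have "{a..<t0} \<noteq> {a}"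
      using dense[OF \<open>a < t0\<close>] by fastforce
    moreover have "{t0<..b} \<noteq> {b}"
      using dense[OF \<open>t0 < b\<close>] by fastforce
    \<comment> \<open>Both states lie on the arc given by the same C and e, hence have the same
      value.\<close>
    ultimately show ?thesis
      using bounce integrals_on_great_arc[OF assms(1,3) C, of e m "{a..<t0}" q v a n]
        integrals_on_great_arc[OF assms(1,3) C, of e m "{t0<..b}" q' v' b n]
      by simp
  qed
qed

section \<open>Independence of the gradients\<close>

text \<open>
  The pairing of the velocity part of the gradient of the second integral with \<open>q \<times> v\<close>.  The velocity
  part of the energy gradient is \<open>v\<close>, so a nonzero value means that the two velocity parts are
  independent in the plane orthogonal to \<open>q\<close>.
\<close>

definition gradient_wronskian :: "real^3 \<Rightarrow> real^3 \<Rightarrow> state \<Rightarrow> real" where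
  "gradient_wronskian Z n = (\<lambda>(q, v). 2 * triple Z q v * (v \<bullet> Z)
     - 2 * (n \<bullet> Z) * (triple n q v * (v \<bullet> Z) + triple Z q v * (v \<bullet> n)))"

text \<open>The phase tangent \<open>(0, cross3 q v)\<close> annihilates the energy gradient and
  pairs with the other one to the wronskian, so \<open>\<beta> = 0\<close>; then
  \<open>(0, v)\<close> leaves \<open>\<alpha> * (v \<bullet> v) = 0\<close>, and the wronskian
  vanishes at \<open>v = 0\<close>.\<close>

lemma gradients_independent:
  assumes "norm Z = 1" "D \<subseteq> sphere 0 1" "p \<in> phase_space Z D" "gradient_wronskian Z n p \<noteq> 0"
    and rel: "\<forall>h\<in>phase_tangent p.
      \<alpha> * (energy_gradient m Z p \<bullet> h) + \<beta> * (second_integral_gradient m Z n p \<bullet> h) = 0"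
  shows "\<alpha> = 0 \<and> \<beta> = 0"
proof -
  obtain q v where p: "p = (q, v)" by fastforce
  have vq: "v \<bullet> q = 0" and qq: "q \<bullet> q = 1" and r: "rad Z q \<noteq> 0"
    using assms rad_pos[of Z q] by (auto simp: phase_space_def p norm_eq_1)
  have t: "triple a q (cross3 q v) = - (v \<bullet> a)" for a
  proof -
    have "triple a q (cross3 q v) = (a \<bullet> q) * (v \<bullet> q) - (v \<bullet> a) * (q \<bullet> q)"
      by (simp add: triple_def cross3_simps)
    then show ?thesis by (simp add: vq qq)
  qed
  have 0: "triple a 0 v = 0" for a by (simp add: triple_def)
  have "(0, cross3 q v) \<in> phase_tangent p"
    by (simp add: phase_tangent_def p dot_cross_self)
  moreover have "energy_gradient m Z p \<bullet> (0, cross3 q v) = 0"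
    by (simp add: energy_gradient_def p inner_prod_def dot_cross_self)
  moreover have "second_integral_gradient m Z n p \<bullet> (0, cross3 q v) = gradient_wronskian Z n p"
    unfolding p second_integral_gradient_inner[OF r] t
    by (simp add: 0 gradient_wronskian_def algebra_simps)
  ultimately have b: "\<beta> = 0" using rel assms(4) by fastforce
  have "(0, v) \<in> phase_tangent p" by (simp add: phase_tangent_def p vq)
  then have "\<alpha> * (v \<bullet> v) = 0"
    using rel b by (fastforce simp: energy_gradient_def p inner_prod_def)
  moreover have "v \<noteq> 0" using assms(4) by (auto simp: gradient_wronskian_def p triple_def)
  ultimately show ?thesis using b by simp
qed

section \<open>Density of the independence set\<close>

text \<open>A finite set does not accumulate at 0. Below, A is the zero set of a nonzero polynomial
  in the path parameter.\<close>

lemma in_closure_along_path: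
  fixes f :: "real \<Rightarrow> 'a::metric_space"
  assumes "(f \<longlongrightarrow> p) (at 0)" "finite A" "\<And>t. t \<notin> A \<Longrightarrow> f t \<in> V"
  shows "p \<in> closure V"
proof (rule Lim_in_closed_set[OF closed_closure _ _ assms(1)])
  have "\<forall>\<^sub>F t in at 0. t \<notin> A"
    using islimpt_finite[OF assms(2)] by (simp add: islimpt_iff_eventually)
  then show "\<forall>\<^sub>F t in at 0. f t \<in> closure V"
    by eventually_elim (use assms(3) closure_subset in blast)
qed simp

text \<open>The wronskian is a quadratic form in the velocity, so on the line
  \<open>v + t *\<^sub>R u\<close> it is a polynomial in t with leading coefficient its value at u.
  One good velocity thus makes the good ones dense in the fibre.\<close>

lemma closure_fibre:
  assumes "(q, v) \<in> phase_space Z D" "u \<bullet> q = 0" "gradient_wronskian Z n (q, u) \<noteq> 0"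
  shows "(q, v) \<in> closure {p \<in> phase_space Z D. gradient_wronskian Z n p \<noteq> 0}"
proof -
  \<comment> \<open>The polarization of the quadratic form at v and u.\<close>
  define b where "b = 2 * (triple Z q v * (u \<bullet> Z) + triple Z q u * (v \<bullet> Z))
     - 2 * (n \<bullet> Z) * (triple n q v * (u \<bullet> Z) + triple n q u * (v \<bullet> Z)
        + triple Z q v * (u \<bullet> n) + triple Z q u * (v \<bullet> n))"
  define w where "w = [:gradient_wronskian Z n (q, v), b, gradient_wronskian Z n (q, u):]"
  have w: "gradient_wronskian Z n (q, v + t *\<^sub>R u) = poly w t" for t
    by (simp add: w_def b_def gradient_wronskian_def triple_add triple_scaleR inner_add_left algebra_simps)
  have "w \<noteq> 0" using assms(3) by (simp add: w_def)
  then have "finite {t. poly w t = 0}" by (rule poly_roots_finite)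
  moreover have "((\<lambda>t. (q, v + t *\<^sub>R u)) \<longlongrightarrow> (q, v)) (at 0)"
    by (auto intro!: tendsto_eq_intros)
  ultimately show ?thesis
    by (rule_tac in_closure_along_path) (use assms in \<open>auto simp: w phase_space_def inner_add_left\<close>)
qed

text \<open>The positions to avoid lie on the great circle through n and Z. Along n \<times> Z the
  triple product is affine in t with nonzero slope; rescaling to the unit sphere keeps it
  nonzero.\<close>

lemma closure_base:
  assumes "cross3 n Z \<noteq> 0" "(q, v) \<in> phase_space Z D" "norm q = 1"
    and side: "D = {q \<in> sphere 0 1. q \<bullet> n \<ge> 0} \<or> D = {q \<in> sphere 0 1. q \<bullet> n \<le> 0}"
  shows "(q, v) \<in> closure {p \<in> phase_space Z D. triple n (fst p) Z \<noteq> 0}"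
proof -
  \<comment> \<open>Moving \<open>q\<close> along \<open>n \<times> Z\<close> does not change the sign of \<open>q \<bullet> n\<close>, so the path stays in \<open>D\<close>.\<close>
  define k where "k = cross3 n Z"
  have nk: "k \<bullet> n = 0" by (simp add: k_def dot_cross_self)
  have kk: "triple n k Z = - (k \<bullet> k)"
    using triple_swap[of n k Z] triple_cyclic[of n Z k] triple_cyclic[of Z k n] by (simp add: triple_def k_def)
  define r where "r t = sgn (q + t *\<^sub>R k)" for t
  define w where "w = [:triple n q Z, triple n k Z:]"
  have w: "triple n (q + t *\<^sub>R k) Z = poly w t" for t
    by (simp add: w_def triple_add triple_scaleR)
  have "w \<noteq> 0" using assms(1) kk by (simp add: w_def k_def)
  then have fin: "finite {t. poly w t = 0}" by (rule poly_roots_finite)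
  have "(r \<longlongrightarrow> sgn (q + 0 *\<^sub>R k)) (at 0)"
    unfolding r_def using assms(3) by (intro tendsto_intros) auto
  then have r: "(r \<longlongrightarrow> q) (at 0)" using assms(3) by (simp add: sgn_div_norm)
  \<comment> \<open>Projecting v makes it tangent at the moved point; the limit is v itself, which
    is already tangent at q.\<close>
  then have "((\<lambda>t. tangential_part (r t) v) \<longlongrightarrow> tangential_part q v) (at 0)"
    unfolding tangential_part_def by (intro tendsto_intros)
  then have lim: "((\<lambda>t. (r t, tangential_part (r t) v)) \<longlongrightarrow> (q, v)) (at 0)"
    using r assms(2) by (auto intro!: tendsto_Pair simp: phase_space_def tangential_part_def)
  show ?thesis
  proof (rule in_closure_along_path[OF lim fin])
    fix t assume "t \<notin> {t. poly w t = 0}"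
    then have "triple n (q + t *\<^sub>R k) Z \<noteq> 0" by (simp add: w)
    then have nz: "q + t *\<^sub>R k \<noteq> 0" and t: "triple n (r t) Z \<noteq> 0"
      by (auto simp: r_def sgn_div_norm triple_scaleR) (simp_all add: triple_def)
    have rr: "r t \<bullet> r t = 1" using nz by (simp add: r_def norm_eq_1[symmetric] norm_sgn)
    have "r t \<bullet> n = (q \<bullet> n) / norm (q + t *\<^sub>R k)"
      by (simp add: r_def sgn_div_norm inner_add_left nk divide_inverse)
    then have "r t \<in> D"
      using side assms(2) rr by (auto simp: phase_space_def norm_eq_1 zero_le_divide_iff divide_le_0_iff)
    moreover have "r t \<noteq> Z" "r t \<noteq> - Z" using t by (auto simp: triple_def)
    moreover have "tangential_part (r t) v \<bullet> r t = 0"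
      by (simp add: tangential_part_def inner_diff_left rr)
    ultimately show "(r t, tangential_part (r t) v) \<in> {p \<in> phase_space Z D. triple n (fst p) Z \<noteq> 0}"
      using t by (simp add: phase_space_def)
  qed
qed

text \<open>If n is orthogonal or parallel to Z, every fibre contains a good velocity. Otherwise q
  is first moved off the great circle through n and Z, and the velocity is perturbed
  afterwards.\<close>

lemma wronskian_nonzero_dense:
  assumes "norm Z = 1" "norm n = 1" "n = Z \<or> c = 0"
    and side: "D = {q \<in> sphere 0 1. q \<bullet> n \<ge> c} \<or> D = {q \<in> sphere 0 1. q \<bullet> n \<le> c}"
  shows "phase_space Z D \<subseteq> closure {p \<in> phase_space Z D. gradient_wronskian Z n p \<noteq> 0}"
    (is "_ \<subseteq> closure ?V")
proof -
  have ZZ: "Z \<bullet> Z = 1" using assms by (simp add: norm_eq_1)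
  have P: "q \<bullet> q = 1" "norm q = 1" "1 - (q \<bullet> Z)\<^sup>2 > 0" if "(q, v) \<in> phase_space Z D" for q v
  proof -
    have "norm q = 1" "q \<noteq> Z" "q \<noteq> - Z" using side that by (auto simp: phase_space_def)
    then show "q \<bullet> q = 1" "norm q = 1" "1 - (q \<bullet> Z)\<^sup>2 > 0"
      using rad_square[of Z q] rad_pos[of Z q] assms by (auto simp: norm_eq_1 simp flip: rad_square)
  qed
  show ?thesis
  proof (cases "n \<bullet> Z = 0 \<or> cross3 n Z = 0")
    case True
    have "(q, v) \<in> closure ?V" if qv: "(q, v) \<in> phase_space Z D" for q v
    proof (rule closure_fibre[OF qv])
      note P = P[OF qv]
      \<comment> \<open>A sum of the meridian and the parallel direction:
        \<open>u \<bullet> Z\<close> and \<open>triple Z q u\<close> both become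
        \<open>1 - (q \<bullet> Z)\<^sup>2\<close>, so their product in the wronskian is
        nonzero.\<close>
      define u where "u = tangential_part q Z + cross3 Z q"
      show "u \<bullet> q = 0"
        by (simp add: u_def tangential_part_def inner_add_left inner_diff_left P dot_cross_self)
      have uZ: "u \<bullet> Z = 1 - (q \<bullet> Z)\<^sup>2"
        by (simp add: u_def tangential_part_def inner_add_left inner_diff_left ZZ dot_cross_self
            inner_commute[of Z q] power2_eq_square)
      have "triple Z q (cross3 Z q) = (Z \<bullet> Z) * (q \<bullet> q) - (q \<bullet> Z)\<^sup>2"
        by (simp add: triple_def cross3_simps power2_eq_square)
      then have L: "triple Z q u = 1 - (q \<bullet> Z)\<^sup>2"
        by (simp add: u_def tangential_part_def triple_add triple_diff triple_scaleR P ZZ)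
      have "gradient_wronskian Z n (q, u) = 2 * (1 - 2 * (n \<bullet> Z)\<^sup>2) * (1 - (q \<bullet> Z)\<^sup>2)\<^sup>2"
        and "1 - 2 * (n \<bullet> Z)\<^sup>2 \<noteq> 0"
      proof -
        have "cross3 Z (cross3 n Z) = (Z \<bullet> Z) *\<^sub>R n - (n \<bullet> Z) *\<^sub>R Z"
          by (simp add: cross3_simps forall_3)
        then have n: "n \<bullet> Z = 0 \<or> n = (n \<bullet> Z) *\<^sub>R Z" using True by (auto simp: ZZ)
        define z where "z = n \<bullet> Z"
        show "gradient_wronskian Z n (q, u) = 2 * (1 - 2 * (n \<bullet> Z)\<^sup>2) * (1 - (q \<bullet> Z)\<^sup>2)\<^sup>2"
          using n
        proof
          assume "n \<bullet> Z = 0"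
          then show ?thesis by (simp add: gradient_wronskian_def uZ L power2_eq_square)
        next
          assume "n = (n \<bullet> Z) *\<^sub>R Z"
          then have "n = z *\<^sub>R Z" by (simp add: z_def)
          then show ?thesis
            by (simp add: gradient_wronskian_def uZ L triple_scaleR ZZ power2_eq_square algebra_simps)
        qed
        have "(n \<bullet> Z)\<^sup>2 = 0 \<or> (n \<bullet> Z)\<^sup>2 = 1"
          using n
        proof
          assume "n = (n \<bullet> Z) *\<^sub>R Z"
          then have "norm n = \<bar>n \<bullet> Z\<bar> * norm Z" by (metis norm_scaleR)
          then show ?thesis using assms by (simp add: abs_square_eq_1)
        qed simp
        then show "1 - 2 * (n \<bullet> Z)\<^sup>2 \<noteq> 0" by auto
      qed
      then show "gradient_wronskian Z n (q, u) \<noteq> 0" using P(3) by simp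
    qed
    then show ?thesis by auto
  next
    case False
    let ?W = "{p \<in> phase_space Z D. triple n (fst p) Z \<noteq> 0}"
    \<comment> \<open>If n were Z, the cross product would vanish; the wall is therefore a great
      circle.\<close>
    have "c = 0" using False assms(3) by auto
    then have "phase_space Z D \<subseteq> closure ?W"
      using closure_base[of n Z _ _ D] False side P(2) by auto
    moreover have "?W \<subseteq> closure ?V"
    proof clarsimp
      fix q v assume qv: "(q, v) \<in> phase_space Z D" and t: "triple n q Z \<noteq> 0"
      note P = P[OF qv]
      \<comment> \<open>In the meridian direction \<open>triple Z q u = 0\<close>, which leaves the
        single term \<open>- 2 * (n \<bullet> Z) * triple n q Z * (u \<bullet> Z)\<close>.\<close>
      define u where "u = tangential_part q Z"
      show "(q, v) \<in> closure ?V"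
      proof (rule closure_fibre[OF qv])
        show "u \<bullet> q = 0" by (simp add: u_def tangential_part_def inner_diff_left P)
        have "u \<bullet> Z = 1 - (q \<bullet> Z)\<^sup>2"
          by (simp add: u_def tangential_part_def inner_diff_left ZZ inner_commute[of Z q] power2_eq_square)
        moreover have "triple a q u = triple a q Z" for a
          by (simp add: u_def tangential_part_def triple_diff triple_scaleR)
        ultimately show "gradient_wronskian Z n (q, u) \<noteq> 0"
          using t False P(3) by (simp add: gradient_wronskian_def)
      qed
    qed
    ultimately show ?thesis
      using closure_minimal[of ?W "closure ?V"] by auto
  qed
qed

section \<open>Openness and integrability\<close>

lemma openin_wronskian_nonzero:
  "openin (top_of_set P) {p \<in> P. gradient_wronskian Z n p \<noteq> 0}"
proof -
  have "continuous_on P (gradient_wronskian Z n)"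
    unfolding gradient_wronskian_def split_def triple_def by (auto intro!: continuous_intros)
  from continuous_openin_preimage_gen[OF this, of "- {0}"] show ?thesis
    by (simp add: vimage_def Int_def open_Compl)
qed

theorem proposition4p1:
  fixes m c :: real and Z n :: "real^3" and D :: "(real^3) set"
  assumes "m \<noteq> 0" and "norm Z = 1" and "norm n = 1"
    and wall: "(n = Z \<and> \<bar>c\<bar> < 1) \<or> c = 0"
    and side: "D = {q \<in> sphere 0 1. q \<bullet> n \<ge> c} \<or> D = {q \<in> sphere 0 1. q \<bullet> n \<le> c}"
  shows "integrable_billiard m Z n c D"
proof -
  have D: "D \<subseteq> sphere 0 1" using side by auto
  have nc: "n = Z \<or> c = 0" using wall by auto
  let ?V = "{p \<in> phase_space Z D. gradient_wronskian Z n p \<noteq> 0}"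
  have "functionally_independent (phase_space Z D) (energy m Z) (second_integral m Z n)"
    unfolding functionally_independent_def
    using C1_with_gradient_energy[OF assms(2) D] C1_with_gradient_second_integral[OF assms(2) D]
      openin_wronskian_nonzero wronskian_nonzero_dense[OF assms(2,3) nc side]
      gradients_independent[OF assms(2) D]
    by (intro exI[of _ "energy_gradient m Z"] exI[of _ "second_integral_gradient m Z n"]
        exI[of _ ?V] conjI) blast+
  then show ?thesis
    unfolding integrable_billiard_def
    using conserved_quantity_energy[OF assms(2) D]
      conserved_quantity_second_integral[OF assms(2,3) D nc] by blast
qed

end
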